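(* For every positive integer $n$, the difference graph $D(\mathbb{Z}_n)$ of the cyclic group $\mathbb{Z}_n$ is perfect.
   Context: For a group $G$, the power graph $\mathsf{Pow}(G)$ has vertex set $G$, with distinct $a,b$ adjacent iff $a\in\langle b\rangle$ or $b\in\langle a\rangle$. The enhanced power graph $\mathsf{EPow}(G)$ has vertex set $G$, with distinct $a,b$ adjacent iff $\langle a,b\rangle$ is cyclic. The difference graph $D(G)$ is the graph $\mathsf{EPow}(G)-\mathsf{Pow}(G)$ with all isolated vertices removed; thus $x\sim y$ in $D(G)$ iff $\langle x,y\rangle$ is cyclic, $x\notin\langle y\rangle$ and $y\notin\langle x\rangle$. *)

theory Defs
  imports "HOL-Algebra.Elementary_Groups" "HOL-Library.Ramsey"
begin

text \<open>
  Edges are two-element sets of vertices, the encoding expected by \<open>clique\<close> from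
  \<open>HOL-Library.Ramsey\<close>.
\<close>

record 'a sgraph =
  verts :: "'a set"
  edges :: "'a set set"

definition simple_graph :: "'a sgraph \<Rightarrow> bool" where
  "simple_graph X \<longleftrightarrow> (\<forall>e\<in>edges X. e \<subseteq> verts X \<and> card e = 2)"

definition induced_subgraph :: "'a sgraph \<Rightarrow> 'a set \<Rightarrow> 'a sgraph" where
  "induced_subgraph X W = \<lparr>verts = W, edges = {e \<in> edges X. e \<subseteq> W}\<rparr>"

definition proper_coloring :: "'a sgraph \<Rightarrow> ('a \<Rightarrow> nat) \<Rightarrow> bool" where
  "proper_coloring X c \<longleftrightarrow> (\<forall>x\<in>verts X. \<forall>y\<in>verts X. {x, y} \<in> edges X \<longrightarrow> c x \<noteq> c y)"

text \<open>The next two numbers are meaningful for finite graphs only.\<close>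

definition chromatic_number :: "'a sgraph \<Rightarrow> nat" where
  "chromatic_number X = (LEAST k. \<exists>c. proper_coloring X c \<and> c ` verts X \<subseteq> {..<k})"

definition clique_number :: "'a sgraph \<Rightarrow> nat" where
  "clique_number X = Max {card K | K. K \<subseteq> verts X \<and> clique K (edges X)}"

definition perfect_graph :: "'a sgraph \<Rightarrow> bool" where
  "perfect_graph X \<longleftrightarrow> simple_graph X \<and> finite (verts X) \<and>
     (\<forall>W \<subseteq> verts X.
        chromatic_number (induced_subgraph X W) = clique_number (induced_subgraph X W))"

definition power_graph :: "('a, 'b) monoid_scheme \<Rightarrow> 'a sgraph" where
  "power_graph G = \<lparr>verts = carrier G,
     edges = {{a, b} | a b. a \<in> carrier G \<and> b \<in> carrier G \<and> a \<noteq> b \<and>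
                (a \<in> generate G {b} \<or> b \<in> generate G {a})}\<rparr>"

definition enhanced_power_graph :: "('a, 'b) monoid_scheme \<Rightarrow> 'a sgraph" where
  "enhanced_power_graph G = \<lparr>verts = carrier G,
     edges = {{a, b} | a b. a \<in> carrier G \<and> b \<in> carrier G \<and> a \<noteq> b \<and>
                cyclic_group (subgroup_generated G {a, b})}\<rparr>"

text \<open>Difference of two graphs on the same vertex set.\<close>

definition edge_difference :: "'a sgraph \<Rightarrow> 'a sgraph \<Rightarrow> 'a sgraph" where
  "edge_difference X Y = \<lparr>verts = verts X, edges = edges X - edges Y\<rparr>"

definition remove_isolated :: "'a sgraph \<Rightarrow> 'a sgraph" where
  "remove_isolated X = \<lparr>verts = {v \<in> verts X. \<exists>e\<in>edges X. v \<in> e}, edges = edges X\<rparr>"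

definition difference_graph :: "('a, 'b) monoid_scheme \<Rightarrow> 'a sgraph" where
  "difference_graph G =
     remove_isolated (edge_difference (enhanced_power_graph G) (power_graph G))"

lemma simple_graph_difference_graph: "simple_graph (difference_graph G)"
  by (auto simp: simple_graph_def difference_graph_def remove_isolated_def edge_difference_def
      enhanced_power_graph_def card_2_iff)

lemma (in group) difference_graph_adjacent_iff:
  assumes "x \<in> carrier G" "y \<in> carrier G"
  shows "{x, y} \<in> edges (difference_graph G) \<longleftrightarrow>
    cyclic_group (subgroup_generated G {x, y}) \<and> x \<notin> generate G {y} \<and> y \<notin> generate G {x}"
proof -
  have "x \<noteq> y" if "x \<notin> generate G {y}"
    using that generate.incl[of y "{y}" G] by auto
  then show ?thesis
    using assms
    by (auto simp: difference_graph_def remove_isolated_def edge_difference_def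
        enhanced_power_graph_def power_graph_def doubleton_eq_iff insert_commute)
qed

end

(* Subgroups of a cyclic group are cyclic, so two elements x and y of a finite cyclic group are
   adjacent in the difference graph iff they are incomparable for the preorder "x is a power of y".
   Hence cliques are antichains, colour classes are chains, and perfection is Dilworth's theorem
   for finite preorders. *)
theory Submission
  imports Defs
begin

section \<open>Dilworth's theorem for finite preorders\<close>

lemma finite_preorder_has_maximal:
  assumes "finite A" "A \<noteq> {}" "transp_on A r"
  shows "\<exists>m\<in>A. \<forall>x\<in>A. r m x \<longrightarrow> r x m"
proof -
  let ?s = "\<lambda>x y. r x y \<and> \<not> r y x"
  have "asymp_on A ?s"
    by (rule asymp_onI) simp
  moreover have "transp_on A ?s"
    using assms(3) unfolding transp_on_def by blast
  ultimately show ?thesis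
    using Finite_Set.bex_max_element[OF assms(1), of ?s] assms(2) by metis
qed

text \<open>Distinct equivalent elements count as comparable, so an antichain of the preorder has at
  most one member per equivalence class.\<close>

definition antichain_on :: "('a \<Rightarrow> 'a \<Rightarrow> bool) \<Rightarrow> 'a set \<Rightarrow> bool" where
  "antichain_on r A \<longleftrightarrow> (\<forall>x\<in>A. \<forall>y\<in>A. r x y \<longrightarrow> x = y)"

text \<open>A partition into at most \<open>k\<close> chains, encoded as a colouring because it
  later becomes a proper colouring of the graph.\<close>

definition chain_coloring :: "('a \<Rightarrow> 'a \<Rightarrow> bool) \<Rightarrow> 'a set \<Rightarrow> nat \<Rightarrow> ('a \<Rightarrow> nat) \<Rightarrow> bool" where
  "chain_coloring r W k c \<longleftrightarrow>
     c ` W \<subseteq> {..<k} \<and> (\<forall>x\<in>W. \<forall>y\<in>W. c x = c y \<longrightarrow> r x y \<or> r y x)"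

lemma chain_coloring_inj_on_antichain:
  assumes "chain_coloring r W k c" "antichain_on r A" "A \<subseteq> W"
  shows "inj_on c A"
  using assms unfolding chain_coloring_def antichain_on_def inj_on_def by (metis subsetD)

lemma card_antichain_le_chain_coloring:
  assumes "chain_coloring r W k c" "antichain_on r A" "A \<subseteq> W"
  shows "card A \<le> k"
proof -
  have "c ` A \<subseteq> {..<k}"
    using assms by (auto simp: chain_coloring_def)
  then show ?thesis
    using card_inj_on_le[OF chain_coloring_inj_on_antichain[OF assms], of "{..<k}"] by simp
qed

text \<open>Elements of equal colour are comparable, so an antichain meets each chain at most once;
  with as many elements as colours it must meet every chain.\<close>

lemma chain_coloring_image_max_antichain:
  assumes "chain_coloring r W k c" "antichain_on r A" "A \<subseteq> W" "card A = k"
  shows "c ` A = {..<k}"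
proof (rule card_subset_eq)
  show "c ` A \<subseteq> {..<k}"
    using assms by (auto simp: chain_coloring_def)
  show "card (c ` A) = card {..<k}"
    using card_image[OF chain_coloring_inj_on_antichain[OF assms(1-3)]] assms(4) by simp
qed simp

text \<open>Each colour class meets some antichain of size \<open>k\<close>; \<open>t i\<close> is a
  highest point of class \<open>i\<close> on such antichains.\<close>

lemma max_antichain_of_tops:
  assumes "finite W" and trans: "transp_on W r"
    and c: "chain_coloring r W k c" and A: "antichain_on r A" "A \<subseteq> W" "card A = k"
  obtains t where "\<And>i. i < k \<Longrightarrow> t i \<in> W \<and> c (t i) = i"
    and "antichain_on r (t ` {..<k})"
    and "\<And>i B z. \<lbrakk>i < k; antichain_on r B; B \<subseteq> W; card B = k; z \<in> B; c z = i\<rbrakk> \<Longrightarrow> r z (t i)"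
proof -
  define S where
    "S i = {z \<in> W. c z = i \<and> (\<exists>B. antichain_on r B \<and> B \<subseteq> W \<and> card B = k \<and> z \<in> B)}" for i
  have "\<exists>m\<in>S i. \<forall>z\<in>S i. r z m" if "i < k" for i
  proof -
    have "i \<in> c ` A"
      using chain_coloring_image_max_antichain[OF c A] that by simp
    then have "S i \<noteq> {}"
      using A by (auto simp: S_def)
    moreover have "finite (S i)" "transp_on (S i) r"
      using \<open>finite W\<close> transp_on_subset[OF trans, of "S i"] by (auto simp: S_def)
    ultimately obtain m where m: "m \<in> S i" "\<forall>z\<in>S i. r m z \<longrightarrow> r z m"
      using finite_preorder_has_maximal by metis
    \<comment> \<open>Within one colour class all elements are comparable, so a maximal one is
      greatest up to equivalence.\<close>
    moreover have "r m z \<or> r z m" if "z \<in> S i" for z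
      using c m(1) that unfolding chain_coloring_def S_def by auto
    ultimately show ?thesis
      by blast
  qed
  then obtain t where t: "\<And>i. i < k \<Longrightarrow> t i \<in> S i \<and> (\<forall>z\<in>S i. r z (t i))"
    by metis
  show ?thesis
  proof
    show W: "t i \<in> W \<and> c (t i) = i" if "i < k" for i
      using t[OF that] by (simp add: S_def)
    show "r z (t i)"
      if "i < k" "antichain_on r B" "B \<subseteq> W" "card B = k" "z \<in> B" "c z = i" for i B z
      using t[OF that(1)] that by (auto simp: S_def)
    have "i = j" if ij: "i < k" "j < k" "r (t i) (t j)" for i j
    proof -
      \<comment> \<open>An antichain of size \<open>k\<close> through \<open>t j\<close> also meets
        class \<open>i\<close>, in some \<open>y\<close> below \<open>t i\<close>. By transitivity
        \<open>y\<close> is below \<open>t j\<close>, so they coincide and their colours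
        agree.\<close>
      obtain B where B: "antichain_on r B" "B \<subseteq> W" "card B = k" "t j \<in> B"
        using t[OF ij(2)] by (auto simp: S_def)
      obtain y where y: "y \<in> B" "c y = i"
        using chain_coloring_image_max_antichain[OF c B(1-3)] ij(1) by (metis imageE lessThan_iff)
      then have "r y (t i)"
        using t[OF ij(1)] B by (auto simp: S_def)
      then have "r y (t j)"
        using trans ij y B W by (meson subsetD transp_onD)
      then show ?thesis
        using B y W ij by (auto simp: antichain_on_def)
    qed
    then show "antichain_on r (t ` {..<k})"
      by (auto simp: antichain_on_def)
  qed
qed

text \<open>Galvin's proof: remove a maximal element \<open>a\<close> and compare it with the antichain formed by
  the topmost elements, in each chain, that lie in some maximum antichain.\<close>

theorem dilworth:
  assumes "finite W" "reflp_on W r" "transp_on W r"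
  shows "\<exists>A c. A \<subseteq> W \<and> antichain_on r A \<and> chain_coloring r W (card A) c"
  using assms
proof (induction W rule: finite_psubset_induct)
  case (psubset W)
  have IH: "\<exists>A c. A \<subseteq> V \<and> antichain_on r A \<and> chain_coloring r V (card A) c" if "V \<subset> W" for V
    using psubset.IH[OF that] reflp_on_subset[OF psubset.prems(1)]
      transp_on_subset[OF psubset.prems(2)] that by blast
  show ?case
  proof (cases "W = {}")
    case True
    then show ?thesis
      by (auto simp: antichain_on_def chain_coloring_def)
  next
    case False
    then obtain a where a: "a \<in> W" "\<forall>x\<in>W. r a x \<longrightarrow> r x a"
      using finite_preorder_has_maximal psubset by metis
    define V where "V = W - {a}"
    have V: "V \<subset> W" "finite V"
      using a psubset.hyps by (auto simp: V_def)
    have trans_V: "transp_on V r"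
      using psubset.prems(2) V by (blast intro: transp_on_subset)
    obtain A c where A: "A \<subseteq> V" "antichain_on r A" and c: "chain_coloring r V (card A) c"
      using IH[OF V(1)] by blast
    define k where "k = card A"
    note c = c[folded k_def]
    obtain t where t: "\<And>i. i < k \<Longrightarrow> t i \<in> V \<and> c (t i) = i"
      and anti: "antichain_on r (t ` {..<k})"
      and top: "\<And>i B z. \<lbrakk>i < k; antichain_on r B; B \<subseteq> V; card B = k; z \<in> B; c z = i\<rbrakk>
        \<Longrightarrow> r z (t i)"
      using max_antichain_of_tops[OF V(2) trans_V c A(2,1) k_def[symmetric]] by metis
    have tk: "card (t ` {..<k}) = k"
      using card_image[of t "{..<k}"] t by (metis card_lessThan inj_onI lessThan_iff)
    show ?thesis
    proof (cases "\<exists>i<k. r (t i) a")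
      case False
      \<comment> \<open>No top lies below \<open>a\<close>, and by maximality of \<open>a\<close> no
        top lies above it either. So \<open>a\<close> enlarges the antichain and gets the fresh
        colour \<open>k\<close>.\<close>
      let ?A = "insert a (t ` {..<k})"
      have "a \<notin> t ` {..<k}"
        using t by (auto simp: V_def)
      then have card: "card ?A = Suc k"
        using tk by simp
      have "antichain_on r ?A"
        unfolding antichain_on_def
      proof (intro ballI impI)
        fix x y assume xy: "x \<in> ?A" "y \<in> ?A" "r x y"
        have no: "\<not> r z a" "\<not> r a z" if "z \<in> t ` {..<k}" for z
          using that False a(2) t V by blast+
        show "x = y"
          using xy no anti unfolding antichain_on_def by blast
      qed
      moreover have "?A \<subseteq> W"
        using a t V by auto
      moreover have "chain_coloring r W (Suc k) (c(a := k))"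
        unfolding chain_coloring_def
      proof (intro conjI ballI impI)
        have less: "c x < k" if "x \<in> W" "x \<noteq> a" for x
          using c that by (auto simp: chain_coloring_def V_def)
        then show "(c(a := k)) ` W \<subseteq> {..<Suc k}"
          by (auto simp: less_SucI)
        fix x y assume xy: "x \<in> W" "y \<in> W" "(c(a := k)) x = (c(a := k)) y"
        then have "x = a \<longleftrightarrow> y = a"
          using less by (metis fun_upd_apply less_irrefl)
        then show "r x y \<or> r y x"
          using xy c reflp_onD[OF psubset.prems(1) a(1)]
          by (cases "x = a") (auto simp: chain_coloring_def V_def)
      qed
      ultimately show ?thesis
        using card by metis
    next
      case True
      then obtain i where i: "i < k" "r (t i) a"
        by blast
      \<comment> \<open>This is a chain: its members from \<open>V\<close> share colour
        \<open>i\<close>, and they lie below \<open>a\<close> through \<open>t i\<close>.\<close>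
      define K where "K = insert a {z \<in> V. c z = i \<and> r z (t i)}"
      have K_below: "r z a" if "z \<in> K" for z
        using that i(2) t[OF i(1)] a(1) V(1) reflp_onD[OF psubset.prems(1) a(1)]
          transp_onD[OF psubset.prems(2), of z "t i" a] unfolding K_def by blast
      have K: "r x y \<or> r y x" if "x \<in> K" "y \<in> K" for x y
        using that K_below c by (auto simp: K_def chain_coloring_def)
      have WK: "W - K \<subset> W"
        using a by (auto simp: K_def)
      obtain A' c' where A': "A' \<subseteq> W - K" "antichain_on r A'"
        and c': "chain_coloring r (W - K) (card A') c'"
        using IH[OF WK] by metis
      have A'V: "A' \<subseteq> V"
        using A' by (auto simp: K_def V_def)
      \<comment> \<open>An antichain of size \<open>k\<close> avoiding \<open>K\<close> would still
        meet class \<open>i\<close>, in a point below \<open>t i\<close> by the choice of tops,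
        hence in \<open>K\<close>.\<close>
      have "card A' \<noteq> k"
      proof
        assume k: "card A' = k"
        obtain z where "z \<in> A'" "c z = i"
          using chain_coloring_image_max_antichain[OF c A'(2) A'V k] i(1)
          by (metis imageE lessThan_iff)
        then have "z \<in> K"
          using top[OF i(1) A'(2) A'V k] A'V by (auto simp: K_def)
        then show False
          using \<open>z \<in> A'\<close> A' by blast
      qed
      then have lt: "card A' < k"
        using card_antichain_le_chain_coloring[OF c A'(2) A'V] by simp
      \<comment> \<open>Colours on \<open>W - K\<close> are below \<open>card A'\<close>, which is
        thus free for \<open>K\<close> and still below \<open>k\<close>. The old antichain
        \<open>A\<close> of size \<open>k\<close> then serves for \<open>W\<close>.\<close>
      have "chain_coloring r W k (\<lambda>x. if x \<in> K then card A' else c' x)"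
        unfolding chain_coloring_def
      proof (intro conjI ballI impI)
        show "(\<lambda>x. if x \<in> K then card A' else c' x) ` W \<subseteq> {..<k}"
          using c' lt by (auto simp: chain_coloring_def image_subset_iff dest: less_trans[OF _ lt])
        show "r x y \<or> r y x" if "x \<in> W" "y \<in> W"
          "(if x \<in> K then card A' else c' x) = (if y \<in> K then card A' else c' y)" for x y
        proof -
          have "c' z \<noteq> card A'" if "z \<in> W - K" for z
            using c' that by (auto simp: chain_coloring_def)
          then show ?thesis
            using that K c' by (auto simp: chain_coloring_def split: if_splits)
        qed
      qed
      then show ?thesis
        using A V by (auto simp: k_def)
    qed
  qed
qed

section \<open>Perfect graphs\<close>

lemma card_clique_le_proper_coloring:
  assumes "proper_coloring X c" "c ` verts X \<subseteq> {..<k}" "K \<subseteq> verts X" "clique K (edges X)"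
  shows "card K \<le> k"
proof -
  have "inj_on c K"
    using assms unfolding inj_on_def proper_coloring_def clique_def by (metis subsetD)
  then show ?thesis
    using card_inj_on_le[of c K "{..<k}"] assms by auto
qed

text \<open>A clique and a proper colouring of equal size certify each other's optimality.\<close>

lemma chromatic_number_eq_clique_numberI:
  assumes "finite (verts X)" "proper_coloring X c" "c ` verts X \<subseteq> {..<card K}"
    and "K \<subseteq> verts X" "clique K (edges X)"
  shows "chromatic_number X = clique_number X"
proof -
  have "chromatic_number X = card K"
    unfolding chromatic_number_def
  proof (rule Least_equality)
    show "\<exists>c. proper_coloring X c \<and> c ` verts X \<subseteq> {..<card K}"
      using assms(2,3) by blast
    show "card K \<le> k" if "\<exists>c. proper_coloring X c \<and> c ` verts X \<subseteq> {..<k}" for k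
      using that card_clique_le_proper_coloring assms(4,5) by blast
  qed
  moreover have "finite {K. K \<subseteq> verts X \<and> clique K (edges X)}"
    using assms(1) by simp
  then have "clique_number X = card K"
    unfolding clique_number_def
    using card_clique_le_proper_coloring[OF assms(2,3)] assms(4,5)
    by (intro Max_eqI) (auto simp: setcompr_eq_image)
  ultimately show ?thesis
    by simp
qed

text \<open>The preorder restricts to every vertex subset \<open>W\<close>, so Dilworth's theorem
  applied to \<open>W\<close> handles each induced subgraph directly.\<close>

lemma perfect_graph_incomparability:
  assumes "simple_graph X" "finite (verts X)" "reflp_on (verts X) r" "transp_on (verts X) r"
    and adj: "\<And>x y. x \<in> verts X \<Longrightarrow> y \<in> verts X \<Longrightarrow>
      {x, y} \<in> edges X \<longleftrightarrow> \<not> r x y \<and> \<not> r y x"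
  shows "perfect_graph X"
  unfolding perfect_graph_def
proof (intro conjI allI impI)
  fix W assume W: "W \<subseteq> verts X"
  obtain A c where A: "A \<subseteq> W" "antichain_on r A" and c: "chain_coloring r W (card A) c"
    using dilworth[of W r] assms W finite_subset reflp_on_subset transp_on_subset by metis
  show "chromatic_number (induced_subgraph X W) = clique_number (induced_subgraph X W)"
  proof (rule chromatic_number_eq_clique_numberI)
    show "finite (verts (induced_subgraph X W))"
      using W assms(2) by (auto simp: induced_subgraph_def intro: finite_subset)
    show "proper_coloring (induced_subgraph X W) c"
      using c adj W by (auto simp: proper_coloring_def chain_coloring_def induced_subgraph_def) blast
    show "c ` verts (induced_subgraph X W) \<subseteq> {..<card A}"
      using c by (auto simp: induced_subgraph_def chain_coloring_def)
    show "A \<subseteq> verts (induced_subgraph X W)"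
      using A by (simp add: induced_subgraph_def)
    show "clique A (edges (induced_subgraph X W))"
      using A W adj by (auto simp: clique_def antichain_on_def induced_subgraph_def subset_iff)
  qed
qed (use assms in auto)

section \<open>Cyclic groups\<close>

text \<open>This makes the cyclicity condition in adjacency automatic. The generator of the pair's
  subgroup is \<open>g\<close> raised to the gcd of the exponents of \<open>x\<close> and
  \<open>y\<close>.\<close>

lemma (in group) cyclic_group_subgroup_generated_pair:
  assumes "cyclic_group G" "x \<in> carrier G" "y \<in> carrier G"
  shows "cyclic_group (subgroup_generated G {x, y})"
proof -
  obtain g where g: "g \<in> carrier G" "carrier G = range (\<lambda>n::int. g [^] n)"
    using assms(1) cyclic_group by blast
  then obtain a b :: int where ab: "x = g [^] a" "y = g [^] b"
    using assms by blast
  obtain u v where uv: "u * a + v * b = gcd a b"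
    using bezout_int by blast
  define z where "z = g [^] gcd a b"
  have z: "z \<in> carrier G"
    using g by (simp add: z_def)
  \<comment> \<open>Bezout's identity in the exponent puts \<open>z\<close> in the subgroup of the
    pair; conversely, the gcd divides both exponents.\<close>
  have "z = x [^] u \<otimes> y [^] v"
    using g(1) by (simp add: z_def ab int_pow_pow int_pow_mult mult.commute flip: uv)
  moreover have "subgroup (generate G {x, y}) G"
    using assms by (intro generate_is_subgroup) auto
  ultimately have "z \<in> generate G {x, y}"
    by (simp add: subgroup.m_closed subgroup_int_pow_closed generate.incl)
  moreover have "x \<in> generate G {z}" "y \<in> generate G {z}"
  proof -
    have "g [^] m \<in> generate G {z}" if m: "gcd a b dvd m" for m
    proof -
      obtain q where q: "m = gcd a b * q"
        using m by (elim dvdE)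
      have "g [^] m = z [^] q"
        using g(1) by (simp add: z_def q int_pow_pow)
      then show ?thesis
        using generate_pow[OF z] by blast
    qed
    then show "x \<in> generate G {z}" "y \<in> generate G {z}"
      by (auto simp: ab)
  qed
  ultimately have "generate G {x, y} = generate G {z}"
    using assms z by (intro equalityI generate_subgroup_incl generate_is_subgroup) auto
  then have "subgroup_generated G {x, y} = subgroup_generated G {z}"
    using assms z by (simp add: subgroup_generated_def)
  then show ?thesis
    by (simp add: cyclic_group_generated)
qed

text \<open>Removing isolated vertices only restricts the preorder to a subset of the
  carrier.\<close>

theorem (in group) perfect_difference_graph_cyclic:
  assumes "cyclic_group G" "finite (carrier G)"
  shows "perfect_graph (difference_graph G)"
proof (rule perfect_graph_incomparability)
  let ?r = "\<lambda>x y. x \<in> generate G {y}"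
  have sub: "verts (difference_graph G) \<subseteq> carrier G"
    by (auto simp: difference_graph_def remove_isolated_def edge_difference_def
        enhanced_power_graph_def)
  show "simple_graph (difference_graph G)"
    by (rule simple_graph_difference_graph)
  show "finite (verts (difference_graph G))"
    using sub assms(2) by (rule finite_subset)
  show "reflp_on (verts (difference_graph G)) ?r"
    by (auto intro: reflp_onI generate.incl)
  have "?r x z" if "y \<in> carrier G" "z \<in> carrier G" "?r x y" "?r y z" for x y z
    using that generate_subgroup_incl[of "{y}" "generate G {z}"] generate_is_subgroup[of "{z}"]
    by auto
  then show "transp_on (verts (difference_graph G)) ?r"
    using sub by (blast intro: transp_onI)
  show "{x, y} \<in> edges (difference_graph G) \<longleftrightarrow> \<not> ?r x y \<and> \<not> ?r y x"
    if "x \<in> verts (difference_graph G)" "y \<in> verts (difference_graph G)" for x y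
    using that sub difference_graph_adjacent_iff cyclic_group_subgroup_generated_pair[OF assms(1)]
    by blast
qed

lemma cyclic_group_integer_mod_group: "cyclic_group (integer_mod_group n)"
proof -
  interpret group "integer_mod_group n"
    by simp
  have "k \<in> range (\<lambda>k. k mod int n)" if "k \<in> carrier (integer_mod_group n)" for k
    using that by (intro range_eqI[of _ _ k]) (auto simp: carrier_integer_mod_group split: if_splits)
  \<comment> \<open>The reduced generator \<open>1 mod int n\<close> also fits the extreme cases: it
    is \<open>0\<close> in the trivial group \<open>n = 1\<close>, and \<open>1\<close> in the
    integers \<open>n = 0\<close>.\<close>
  then have "carrier (integer_mod_group n) =
      range (\<lambda>k::int. (1 mod int n) [^]\<^bsub>integer_mod_group n\<^esub> k)"
    by (auto simp: int_pow_integer_mod_group carrier_integer_mod_group mod_mult_right_eq)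
  then show ?thesis
    unfolding cyclic_group
  proof (intro bexI)
    show "1 mod int n \<in> carrier (integer_mod_group n)"
      by (simp add: carrier_integer_mod_group)
  qed
qed

theorem theorem7p1:
  fixes n :: nat
  assumes "n > 0"
  shows "perfect_graph (difference_graph (integer_mod_group n))"
  \<comment> \<open>Positivity of \<open>n\<close> makes the carrier finite.\<close>
  using assms by (intro group.perfect_difference_graph_cyclic)
    (auto simp: cyclic_group_integer_mod_group carrier_integer_mod_group)

end
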